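(* Let $\mathcal{H}$ be a complex reproducing kernel Hilbert space on a non-empty set $\Omega$, and let $A\in\mathcal{B}(\mathcal{H})$. Then $$\mathbf{ber}^2(\mathrm{Re}(A))+\mathbf{ber}^2(\mathrm{Im}(A))+c^2(\mathrm{Re}(A))+c^2(\mathrm{Im}(A))\leq 2\,\mathbf{ber}^2(A)\leq 2\|A\|^2_{ber}.$$
   Context: Let $\Omega$ be a non-empty set. A complex reproducing kernel Hilbert space $\mathcal{H}$ on $\Omega$ is a complex Hilbert space consisting of functions $\Omega\to\mathbb{C}$ such that every evaluation $f\mapsto f(\lambda)$, $\lambda\in\Omega$, is bounded. For $\lambda\in\Omega$, $k_\lambda\in\mathcal{H}$ is the unique vector with $f(\lambda)=\langle f,k_\lambda\rangle$ for all $f\in\mathcal{H}$; it is assumed that $k_\lambda\neq 0$ for every $\lambda$, and $\hat{k}_\lambda=k_\lambda/\|k_\lambda\|$. $\mathcal{B}(\mathcal{H})$ is the set of bounded linear operators on $\mathcal{H}$. For $A\in\mathcal{B}(\mathcal{H})$: the Berezin number is $\mathbf{ber}(A)=\sup_{\lambda\in\Omega}|\langle A\hat{k}_\lambda,\hat{k}_\lambda\rangle|$; $c(A)=\inf_{\lambda\in\Omega}|\langle A\hat{k}_\lambda,\hat{k}_\lambda\rangle|$; the Berezin norm is $\|A\|_{ber}=\sup_{\lambda,\mu\in\Omega}|\langle A\hat{k}_\lambda,\hat{k}_\mu\rangle|$. Also $\mathbf{ber}^2(A)=(\mathbf{ber}(A))^2$ and $c^2(A)=(c(A))^2$. $\mathrm{Re}(A)=\frac{A+A^*}{2}$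 and $\mathrm{Im}(A)=\frac{A-A^*}{2\mathrm{i}}$. *)

theory Defs
  imports "HOL-Analysis.Analysis"
begin

text \<open>
  The underlying non-empty set is rendered as an arbitrary type \<open>'a\<close>. A space of functions is given
  by a carrier \<open>H\<close> and an inner product \<open>ip\<close>, linear in its first argument; the values of \<open>ip\<close> outside
  \<open>H\<close> are irrelevant.
\<close>

definition ip_norm :: "(('a \<Rightarrow> complex) \<Rightarrow> ('a \<Rightarrow> complex) \<Rightarrow> complex) \<Rightarrow> ('a \<Rightarrow> complex) \<Rightarrow> real" where
  "ip_norm ip f = sqrt (Re (ip f f))"

locale complex_function_hilbert_space =
  fixes H :: "('a \<Rightarrow> complex) set"
    and ip :: "('a \<Rightarrow> complex) \<Rightarrow> ('a \<Rightarrow> complex) \<Rightarrow> complex"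
  assumes zero_mem: "(\<lambda>x. 0) \<in> H"
    and add_mem: "f \<in> H \<Longrightarrow> g \<in> H \<Longrightarrow> (\<lambda>x. f x + g x) \<in> H"
    and scale_mem: "f \<in> H \<Longrightarrow> (\<lambda>x. c * f x) \<in> H"
    and ip_add: "f \<in> H \<Longrightarrow> g \<in> H \<Longrightarrow> h \<in> H \<Longrightarrow> ip (\<lambda>x. f x + g x) h = ip f h + ip g h"
    and ip_scale: "f \<in> H \<Longrightarrow> g \<in> H \<Longrightarrow> ip (\<lambda>x. c * f x) g = c * ip f g"
    and ip_cnj: "f \<in> H \<Longrightarrow> g \<in> H \<Longrightarrow> ip g f = cnj (ip f g)"
    and ip_nonneg: "f \<in> H \<Longrightarrow> 0 \<le> Re (ip f f)"
    and ip_definite: "f \<in> H \<Longrightarrow> ip f f = 0 \<Longrightarrow> f = (\<lambda>x. 0)"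
    and complete: "(\<And>n. s n \<in> H) \<Longrightarrow>
          (\<forall>e>0. \<exists>N. \<forall>m\<ge>N. \<forall>n\<ge>N. ip_norm ip (\<lambda>x. s m x - s n x) < e) \<Longrightarrow>
          \<exists>f\<in>H. (\<lambda>n. ip_norm ip (\<lambda>x. s n x - f x)) \<longlonglongrightarrow> 0"

locale complex_rkhs = complex_function_hilbert_space H ip
  for H :: "('a \<Rightarrow> complex) set" and ip +
  assumes bounded_eval: "\<exists>C. \<forall>f\<in>H. cmod (f x) \<le> C * ip_norm ip f"

definition rkernel ::
  "('a \<Rightarrow> complex) set \<Rightarrow> (('a \<Rightarrow> complex) \<Rightarrow> ('a \<Rightarrow> complex) \<Rightarrow> complex) \<Rightarrow> 'a \<Rightarrow> ('a \<Rightarrow> complex)" where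
  "rkernel H ip l = (THE k. k \<in> H \<and> (\<forall>f\<in>H. f l = ip f k))"

definition normalized_rkernel ::
  "('a \<Rightarrow> complex) set \<Rightarrow> (('a \<Rightarrow> complex) \<Rightarrow> ('a \<Rightarrow> complex) \<Rightarrow> complex) \<Rightarrow> 'a \<Rightarrow> ('a \<Rightarrow> complex)" where
  "normalized_rkernel H ip l =
     (\<lambda>x. rkernel H ip l x / complex_of_real (ip_norm ip (rkernel H ip l)))"

definition bounded_operator ::
  "('a \<Rightarrow> complex) set \<Rightarrow> (('a \<Rightarrow> complex) \<Rightarrow> ('a \<Rightarrow> complex) \<Rightarrow> complex)
    \<Rightarrow> (('a \<Rightarrow> complex) \<Rightarrow> ('a \<Rightarrow> complex)) \<Rightarrow> bool" where
  "bounded_operator H ip A \<longleftrightarrow>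
     (\<forall>f\<in>H. A f \<in> H) \<and>
     (\<forall>f\<in>H. \<forall>g\<in>H. A (\<lambda>x. f x + g x) = (\<lambda>x. A f x + A g x)) \<and>
     (\<forall>c. \<forall>f\<in>H. A (\<lambda>x. c * f x) = (\<lambda>x. c * A f x)) \<and>
     (\<exists>C. \<forall>f\<in>H. ip_norm ip (A f) \<le> C * ip_norm ip f)"

text \<open>
  The adjoint is described pointwise: as operators are functions on the whole type, the defining
  identity determines \<open>A\<^sup>*\<close> uniquely only on \<open>H\<close>.
\<close>

definition hadjoint ::
  "('a \<Rightarrow> complex) set \<Rightarrow> (('a \<Rightarrow> complex) \<Rightarrow> ('a \<Rightarrow> complex) \<Rightarrow> complex)
    \<Rightarrow> (('a \<Rightarrow> complex) \<Rightarrow> ('a \<Rightarrow> complex)) \<Rightarrow> (('a \<Rightarrow> complex) \<Rightarrow> ('a \<Rightarrow> complex))" where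
  "hadjoint H ip A g = (THE h. h \<in> H \<and> (\<forall>f\<in>H. ip (A f) g = ip f h))"

definition re_operator ::
  "('a \<Rightarrow> complex) set \<Rightarrow> (('a \<Rightarrow> complex) \<Rightarrow> ('a \<Rightarrow> complex) \<Rightarrow> complex)
    \<Rightarrow> (('a \<Rightarrow> complex) \<Rightarrow> ('a \<Rightarrow> complex)) \<Rightarrow> (('a \<Rightarrow> complex) \<Rightarrow> ('a \<Rightarrow> complex))" where
  "re_operator H ip A f = (\<lambda>x. (A f x + hadjoint H ip A f x) / 2)"

definition im_operator ::
  "('a \<Rightarrow> complex) set \<Rightarrow> (('a \<Rightarrow> complex) \<Rightarrow> ('a \<Rightarrow> complex) \<Rightarrow> complex)
    \<Rightarrow> (('a \<Rightarrow> complex) \<Rightarrow> ('a \<Rightarrow> complex)) \<Rightarrow> (('a \<Rightarrow> complex) \<Rightarrow> ('a \<Rightarrow> complex))" where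
  "im_operator H ip A f = (\<lambda>x. (A f x - hadjoint H ip A f x) / (2 * \<i>))"

definition berezin_number ::
  "('a \<Rightarrow> complex) set \<Rightarrow> (('a \<Rightarrow> complex) \<Rightarrow> ('a \<Rightarrow> complex) \<Rightarrow> complex)
    \<Rightarrow> (('a \<Rightarrow> complex) \<Rightarrow> ('a \<Rightarrow> complex)) \<Rightarrow> real" where
  "berezin_number H ip A =
     (SUP l. cmod (ip (A (normalized_rkernel H ip l)) (normalized_rkernel H ip l)))"

definition berezin_inf ::
  "('a \<Rightarrow> complex) set \<Rightarrow> (('a \<Rightarrow> complex) \<Rightarrow> ('a \<Rightarrow> complex) \<Rightarrow> complex)
    \<Rightarrow> (('a \<Rightarrow> complex) \<Rightarrow> ('a \<Rightarrow> complex)) \<Rightarrow> real" where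
  "berezin_inf H ip A =
     (INF l. cmod (ip (A (normalized_rkernel H ip l)) (normalized_rkernel H ip l)))"

definition berezin_norm ::
  "('a \<Rightarrow> complex) set \<Rightarrow> (('a \<Rightarrow> complex) \<Rightarrow> ('a \<Rightarrow> complex) \<Rightarrow> complex)
    \<Rightarrow> (('a \<Rightarrow> complex) \<Rightarrow> ('a \<Rightarrow> complex)) \<Rightarrow> real" where
  "berezin_norm H ip A =
     (SUP (l, m). cmod (ip (A (normalized_rkernel H ip l)) (normalized_rkernel H ip m)))"

end

theory Submission
  imports Defs
begin

text \<open>
  For a unit vector \<open>e\<close> write \<open>z = \<langle>A e, e\<rangle>\<close>. Since \<open>\<langle>A\<^sup>* e, e\<rangle>\<close> is the conjugate of \<open>z\<close>, the Berezin
  symbols of \<open>Re A\<close> and \<open>Im A\<close> are the real and the imaginary part of the Berezin symbol of \<open>A\<close>. For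
  every point, \<open>\<bar>Re z\<bar>\<^sup>2 + inf \<bar>Im z\<bar>\<^sup>2 \<le> \<bar>z\<bar>\<^sup>2 \<le> ber\<^sup>2 A\<close>, and taking the supremum gives
  \<open>ber\<^sup>2 (Re A) + c\<^sup>2 (Im A) \<le> ber\<^sup>2 A\<close>. The same with real and imaginary part exchanged,
  added to this, is the first inequality. The second one compares a supremum over the diagonal with
  the supremum over all pairs of points.

  What needs Hilbert space theory is that all these objects behave as their names promise:
  kernels and adjoints are given by definite descriptions, which are meaningful only by the Riesz
  representation theorem (\<open>riesz_representation\<close>), and the suprema are suprema of bounded sets only by
  the Cauchy--Schwarz inequality (\<open>cauchy_schwarz\<close>). Both rest on the same remark about
  nonnegative quadratic polynomials, \<open>nonneg_quadratic\<close>: the Riesz vector of \<open>\<phi>\<close> is found as the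
  minimiser of \<open>\<parallel>f\<parallel>\<^sup>2 - 2 Re (\<phi> f)\<close>, and at a minimiser the linear term of the variation vanishes.
\<close>

section \<open>Suprema and infima of real and imaginary parts\<close>

text \<open>
  Each value satisfies \<open>u\<^sup>2 \<le> W\<^sup>2 - V\<^sup>2\<close>, where \<open>W\<close> is the supremum of \<open>w\<close> and \<open>V\<close> the infimum
  of \<open>v\<close>; so the supremum of \<open>u\<close> is at most the square root of the right-hand side.
\<close>

lemma SUP_power2_plus_INF_power2_le:
  fixes u v w :: "'a \<Rightarrow> real"
  assumes "\<And>l. 0 \<le> u l" "\<And>l. 0 \<le> v l" "\<And>l. 0 \<le> w l"
    and sq: "\<And>l. (u l)\<^sup>2 + (v l)\<^sup>2 \<le> (w l)\<^sup>2"
    and bdd: "bdd_above (range w)"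
  shows "(SUP l. u l)\<^sup>2 + (INF l. v l)\<^sup>2 \<le> (SUP l. w l)\<^sup>2"
proof -
  define W where "W = (SUP l. w l)"
  define V where "V = (INF l. v l)"
  have V0: "0 \<le> V" unfolding V_def using assms(2) by (intro cINF_greatest) auto
  have key: "(u l)\<^sup>2 + V\<^sup>2 \<le> W\<^sup>2" for l
  proof -
    have "V \<le> v l" unfolding V_def using assms(2) by (intro cINF_lower bdd_belowI2) auto
    then have "V\<^sup>2 \<le> (v l)\<^sup>2" using V0 by (rule power_mono)
    moreover have "w l \<le> W" unfolding W_def using bdd by (intro cSUP_upper) auto
    then have "(w l)\<^sup>2 \<le> W\<^sup>2" using assms(3) by (rule power_mono)
    ultimately show ?thesis using sq[of l] by linarith
  qed
  have le: "u l \<le> sqrt (W\<^sup>2 - V\<^sup>2)" for l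
    using key[of l] by (intro real_le_rsqrt) simp
  have "(SUP l. u l) \<le> sqrt (W\<^sup>2 - V\<^sup>2)"
    using le by (intro cSUP_least) auto
  \<comment> \<open>The index type is nonempty; \<open>undefined\<close> serves as an arbitrary point of it.\<close>
  moreover have "0 \<le> u undefined" "u undefined \<le> (SUP l. u l)"
    using assms(1) le by (auto intro!: cSUP_upper bdd_aboveI2)
  ultimately have "(SUP l. u l)\<^sup>2 \<le> (sqrt (W\<^sup>2 - V\<^sup>2))\<^sup>2"
    by (intro power_mono) auto
  also have "\<dots> = W\<^sup>2 - V\<^sup>2"
    using key[of undefined] zero_le_power2[of "u undefined"] by (intro real_sqrt_pow2) linarith
  finally show ?thesis by (simp add: W_def V_def)
qed

lemma SUP_INF_Re_Im_le:
  fixes z :: "'a \<Rightarrow> complex"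
  assumes "bdd_above (range (\<lambda>l. cmod (z l)))"
  shows "(SUP l. \<bar>Re (z l)\<bar>)\<^sup>2 + (SUP l. \<bar>Im (z l)\<bar>)\<^sup>2 + (INF l. \<bar>Re (z l)\<bar>)\<^sup>2 + (INF l. \<bar>Im (z l)\<bar>)\<^sup>2
           \<le> 2 * (SUP l. cmod (z l))\<^sup>2"
proof -
  have "(SUP l. \<bar>Re (z l)\<bar>)\<^sup>2 + (INF l. \<bar>Im (z l)\<bar>)\<^sup>2 \<le> (SUP l. cmod (z l))\<^sup>2"
    using assms by (intro SUP_power2_plus_INF_power2_le) (auto simp: cmod_power2)
  moreover have "(SUP l. \<bar>Im (z l)\<bar>)\<^sup>2 + (INF l. \<bar>Re (z l)\<bar>)\<^sup>2 \<le> (SUP l. cmod (z l))\<^sup>2"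
    using assms by (intro SUP_power2_plus_INF_power2_le) (auto simp: cmod_power2)
  ultimately show ?thesis by linarith
qed

section \<open>The Cauchy--Schwarz inequality and the Riesz representation theorem\<close>

text \<open>
  With \<open>c = 0\<close> the conclusion says \<open>b = 0\<close>, so this lemma serves both for the Cauchy--Schwarz
  inequality and for the first-order condition at a minimum.
\<close>

lemma nonneg_quadratic:
  fixes a b c :: real
  assumes "0 \<le> a" and nonneg: "\<And>t. 0 \<le> a * t\<^sup>2 + 2 * b * t + c"
  shows "b\<^sup>2 \<le> a * c"
proof (cases "a = 0")
  case True
  have "b = 0"
  proof (rule ccontr)
    assume "b \<noteq> 0"
    then show False using nonneg[of "- (c + 1) / (2 * b)"] True by (simp add: field_simps)
  qed
  then show ?thesis using True by simp
next
  case False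
  with assms(1) have "a > 0" by simp
  then show ?thesis
    using nonneg[of "- b / a"] by (simp add: field_simps power2_eq_square)
qed

context complex_function_hilbert_space
begin

lemma diff_mem: "f \<in> H \<Longrightarrow> g \<in> H \<Longrightarrow> (\<lambda>x. f x - g x) \<in> H"
  using add_mem[of f "\<lambda>x. (-1) * g x"] scale_mem[of g "-1"] by simp

lemma ip_diff: "f \<in> H \<Longrightarrow> g \<in> H \<Longrightarrow> h \<in> H \<Longrightarrow> ip (\<lambda>x. f x - g x) h = ip f h - ip g h"
  using ip_add[of f "\<lambda>x. (-1) * g x" h] ip_scale[of g h "-1"] scale_mem[of g "-1"] by simp

lemma ip_add_right: "f \<in> H \<Longrightarrow> g \<in> H \<Longrightarrow> h \<in> H \<Longrightarrow> ip h (\<lambda>x. f x + g x) = ip h f + ip h g"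
  using ip_add[of f g h] ip_cnj[of _ h] add_mem[of f g] by simp

lemma ip_diff_right: "f \<in> H \<Longrightarrow> g \<in> H \<Longrightarrow> h \<in> H \<Longrightarrow> ip h (\<lambda>x. f x - g x) = ip h f - ip h g"
  using ip_diff[of f g h] ip_cnj[of _ h] diff_mem[of f g] by simp

lemma ip_scale_right: "f \<in> H \<Longrightarrow> g \<in> H \<Longrightarrow> ip g (\<lambda>x. c * f x) = cnj c * ip g f"
  using ip_scale[of f g c] ip_cnj[of _ g] scale_mem[of f c] by simp

lemma Re_ip_commute: "f \<in> H \<Longrightarrow> g \<in> H \<Longrightarrow> Re (ip g f) = Re (ip f g)"
  using ip_cnj[of f g] by simp

lemma ip_norm_power2: "f \<in> H \<Longrightarrow> (ip_norm ip f)\<^sup>2 = Re (ip f f)"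
  using ip_nonneg by (simp add: ip_norm_def)

lemma ip_norm_nonneg: "f \<in> H \<Longrightarrow> 0 \<le> ip_norm ip f"
  using ip_nonneg by (simp add: ip_norm_def)

lemma ip_self: "f \<in> H \<Longrightarrow> ip f f = complex_of_real ((ip_norm ip f)\<^sup>2)"
  using ip_cnj[of f f] by (simp add: ip_norm_power2 complex_eq_iff)

lemma ip_norm_eq_0: "f \<in> H \<Longrightarrow> ip_norm ip f = 0 \<Longrightarrow> f = (\<lambda>x. 0)"
  using ip_definite[of f] by (simp add: ip_self)

lemma Re_ip_add_scaled:
  assumes "f \<in> H" "g \<in> H"
  shows "Re (ip (\<lambda>x. f x + complex_of_real t * g x) (\<lambda>x. f x + complex_of_real t * g x))
           = Re (ip g g) * t\<^sup>2 + 2 * Re (ip f g) * t + Re (ip f f)"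
  using assms Re_ip_commute[of f g]
  by (simp add: ip_add ip_add_right ip_scale ip_scale_right scale_mem add_mem
      power2_eq_square algebra_simps)

lemma Re_ip_power2_le:
  assumes "f \<in> H" "g \<in> H"
  shows "(Re (ip f g))\<^sup>2 \<le> Re (ip g g) * Re (ip f f)"
proof (rule nonneg_quadratic)
  show "0 \<le> Re (ip g g) * t\<^sup>2 + 2 * Re (ip f g) * t + Re (ip f f)" for t
    using Re_ip_add_scaled[OF assms, of t]
      ip_nonneg[OF add_mem[OF assms(1) scale_mem[OF assms(2)]], of "complex_of_real t"] by simp
qed (use assms ip_nonneg in auto)

text \<open>
  Multiplying \<open>f\<close> by the conjugate of the sign of \<open>ip f g\<close> turns the inner product into its
  modulus and does not increase the norm, so that the inequality for real parts applies.
\<close>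

lemma cauchy_schwarz:
  assumes f: "f \<in> H" and g: "g \<in> H"
  shows "cmod (ip f g) \<le> ip_norm ip f * ip_norm ip g"
proof -
  define c where "c = cnj (sgn (ip f g))"
  let ?h = "\<lambda>x. c * f x"
  have h: "?h \<in> H" using f by (rule scale_mem)
  have "c * ip f g = ip f g * cnj (ip f g) / complex_of_real (cmod (ip f g))"
    by (simp add: c_def sgn_eq)
  also have "\<dots> = complex_of_real (cmod (ip f g))"
    unfolding complex_norm_square[symmetric] by (simp add: power2_eq_square)
  finally have "c * ip f g = complex_of_real (cmod (ip f g))" .
  then have "Re (ip ?h g) = cmod (ip f g)" using ip_scale[OF f g, of c] by simp
  moreover have "Re (ip ?h ?h) = (cmod c)\<^sup>2 * Re (ip f f)"
  proof -
    have "ip ?h ?h = (c * cnj c) * ip f f"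
      using f h by (simp add: ip_scale ip_scale_right)
    also have "c * cnj c = complex_of_real ((cmod c)\<^sup>2)"
      by (rule complex_norm_square[symmetric])
    finally show ?thesis by simp
  qed
  moreover have "(cmod c)\<^sup>2 * Re (ip f f) \<le> Re (ip f f)"
    using ip_nonneg[OF f] by (auto simp: c_def norm_sgn)
  ultimately have "(cmod (ip f g))\<^sup>2 \<le> Re (ip g g) * Re (ip f f)"
    using Re_ip_power2_le[OF h g] mult_left_mono[OF _ ip_nonneg[OF g]] by (metis order_trans)
  also have "\<dots> = (ip_norm ip f * ip_norm ip g)\<^sup>2"
    using f g by (simp add: power_mult_distrib ip_norm_power2)
  finally show ?thesis
    by (rule power2_le_imp_le) (intro mult_nonneg_nonneg ip_norm_nonneg f g)
qed

text \<open>
  A vector is determined by its inner products: a difference of two candidates would be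
  orthogonal to itself.
\<close>

lemma eq_if_ip_eq:
  assumes "k \<in> H" "k' \<in> H" "\<And>f. f \<in> H \<Longrightarrow> ip f k = ip f k'"
  shows "k = k'"
proof -
  let ?d = "\<lambda>x. k x - k' x"
  have d: "?d \<in> H" using assms by (intro diff_mem)
  have "ip ?d ?d = 0" using assms d by (simp add: ip_diff_right)
  with d have "?d = (\<lambda>x. 0)" by (intro ip_definite)
  then show ?thesis by (auto simp: fun_eq_iff)
qed

text \<open>
  Let \<open>J f = \<parallel>f\<parallel>\<^sup>2 - 2 Re (\<phi> f)\<close>. It is bounded below since \<open>\<phi>\<close> is bounded. As
  \<open>\<phi>\<close> is linear, the parallelogram law shows
  \<open>J f + J g - 2 J ((f + g) / 2) = \<parallel>f - g\<parallel>\<^sup>2 / 2\<close>, whence a minimising sequence is Cauchy. Its limit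
  represents \<open>\<phi>\<close>: perturbing the sequence by \<open>t h\<close> and passing to the limit gives a quadratic
  polynomial in \<open>t\<close> that is nonnegative and vanishes at \<open>0\<close>.
\<close>

theorem riesz_representation:
  fixes \<phi> :: "('a \<Rightarrow> complex) \<Rightarrow> complex"
  assumes add: "\<And>f g. f \<in> H \<Longrightarrow> g \<in> H \<Longrightarrow> \<phi> (\<lambda>x. f x + g x) = \<phi> f + \<phi> g"
    and scale: "\<And>c f. f \<in> H \<Longrightarrow> \<phi> (\<lambda>x. c * f x) = c * \<phi> f"
    and bounded: "\<And>f. f \<in> H \<Longrightarrow> cmod (\<phi> f) \<le> C * ip_norm ip f"
  shows "\<exists>!k. k \<in> H \<and> (\<forall>f\<in>H. \<phi> f = ip f k)"
proof -
  define J where "J f = Re (ip f f) - 2 * Re (\<phi> f)" for f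
  have lower: "- C\<^sup>2 \<le> J f" if f: "f \<in> H" for f
  proof -
    have "Re (\<phi> f) \<le> C * ip_norm ip f"
      using bounded[OF f] complex_Re_le_cmod[of "\<phi> f"] by linarith
    moreover have "0 \<le> (ip_norm ip f - C)\<^sup>2" by simp
    ultimately show ?thesis
      using ip_norm_power2[OF f] unfolding J_def power2_diff by (simp add: mult.commute)
  qed
  define d where "d = (INF f\<in>H. J f)"
  have bdd: "bdd_below (J ` H)" using lower by (intro bdd_belowI2) auto
  have d_le: "d \<le> J f" if "f \<in> H" for f
    unfolding d_def using bdd that by (rule cINF_lower)
  have "\<exists>f\<in>H. J f < d + 1 / real (Suc n)" for n
  proof -
    have "d < d + 1 / real (Suc n)" by simp
    then show ?thesis unfolding d_def using zero_mem bdd by (subst (asm) cINF_less_iff) auto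
  qed
  then obtain s where s: "\<And>n. s n \<in> H" and s_lt: "\<And>n. J (s n) < d + 1 / real (Suc n)"
    by metis
  have close: "(ip_norm ip (\<lambda>x. f x - g x))\<^sup>2 \<le> 2 * (J f + J g - 2 * d)"
    if f: "f \<in> H" and g: "g \<in> H" for f g
  proof -
    define m where "m = (\<lambda>x. (1/2) * (f x + g x))"
    have m: "m \<in> H" unfolding m_def using f g by (intro scale_mem add_mem)
    have "Re (ip m m) = (Re (ip f f) + 2 * Re (ip f g) + Re (ip g g)) / 4"
      using f g m Re_ip_commute[of f g] unfolding m_def
      by (simp only: ip_scale ip_scale_right ip_add ip_add_right add_mem) simp
    moreover have "Re (\<phi> m) = (Re (\<phi> f) + Re (\<phi> g)) / 2"
      unfolding m_def scale[OF add_mem[OF f g]] add[OF f g] by simp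
    moreover have "(ip_norm ip (\<lambda>x. f x - g x))\<^sup>2 = Re (ip f f) - 2 * Re (ip f g) + Re (ip g g)"
      using f g Re_ip_commute[of f g]
      by (simp add: ip_norm_power2 diff_mem ip_diff ip_diff_right)
    ultimately have "(ip_norm ip (\<lambda>x. f x - g x))\<^sup>2 = 2 * (J f + J g - 2 * J m)"
      unfolding J_def by argo
    also have "\<dots> \<le> 2 * (J f + J g - 2 * d)"
      using d_le[OF m] by simp
    finally show ?thesis .
  qed
  have cauchy: "\<exists>N. \<forall>m\<ge>N. \<forall>n\<ge>N. ip_norm ip (\<lambda>x. s m x - s n x) < e" if e: "e > 0" for e
  proof -
    from e obtain N where N: "1 / real (Suc N) < e\<^sup>2 / 4"
      using nat_approx_posE[of "e\<^sup>2 / 4"] by auto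
    have small: "J (s n) - d < e\<^sup>2 / 4" if "n \<ge> N" for n
    proof -
      have "1 / real (Suc n) \<le> 1 / real (Suc N)" using that by (intro divide_left_mono) auto
      then show ?thesis using N s_lt[of n] by linarith
    qed
    have "ip_norm ip (\<lambda>x. s m x - s n x) < e" if "m \<ge> N" "n \<ge> N" for m n
    proof (rule power2_less_imp_less)
      have "(ip_norm ip (\<lambda>x. s m x - s n x))\<^sup>2 \<le> 2 * (J (s m) + J (s n) - 2 * d)"
        by (rule close[OF s s])
      also have "\<dots> < e\<^sup>2"
        using small[OF that(1)] small[OF that(2)] by argo
      finally show "(ip_norm ip (\<lambda>x. s m x - s n x))\<^sup>2 < e\<^sup>2" .
    qed (use e in simp)
    then show ?thesis by blast
  qed
  obtain k where k: "k \<in> H" and lim: "(\<lambda>n. ip_norm ip (\<lambda>x. s n x - k x)) \<longlonglongrightarrow> 0"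
    using complete[of s] s cauchy by blast
  have Re_eq: "Re (ip k h) = Re (\<phi> h)" if h: "h \<in> H" for h
  proof -
    have "(\<lambda>n. ip (s n) h - ip k h) \<longlonglongrightarrow> 0"
    proof (rule Lim_null_comparison)
      show "\<forall>\<^sub>F n in sequentially.
          norm (ip (s n) h - ip k h) \<le> ip_norm ip (\<lambda>x. s n x - k x) * ip_norm ip h"
        using cauchy_schwarz[OF diff_mem[OF s k] h] s k h by (simp add: ip_diff)
      show "(\<lambda>n. ip_norm ip (\<lambda>x. s n x - k x) * ip_norm ip h) \<longlonglongrightarrow> 0"
        using tendsto_mult_right[OF lim] by simp
    qed
    then have "(\<lambda>n. ip (s n) h) \<longlonglongrightarrow> ip k h" by (simp add: LIM_zero_iff)
    then have lim_h: "(\<lambda>n. Re (ip (s n) h)) \<longlonglongrightarrow> Re (ip k h)" by (rule tendsto_Re)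
    have "(Re (ip k h) - Re (\<phi> h))\<^sup>2 \<le> Re (ip h h) * 0"
    proof (rule nonneg_quadratic)
      fix t :: real
      have "- (1 / real (Suc n))
          \<le> Re (ip h h) * t\<^sup>2 + 2 * (Re (ip (s n) h) - Re (\<phi> h)) * t" for n
      proof -
        let ?p = "\<lambda>x. s n x + complex_of_real t * h x"
        have "d \<le> J ?p" using s h by (intro d_le add_mem scale_mem)
        also have "J ?p = J (s n) + (Re (ip h h) * t\<^sup>2 + 2 * (Re (ip (s n) h) - Re (\<phi> h)) * t)"
          unfolding J_def Re_ip_add_scaled[OF s h] using s h
          by (simp add: add scale scale_mem algebra_simps)
        finally show ?thesis using s_lt[of n] by linarith
      qed
      moreover have "(\<lambda>n. - (1 / real (Suc n))) \<longlonglongrightarrow> 0"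
        using tendsto_minus[OF LIMSEQ_inverse_real_of_nat] by (simp add: inverse_eq_divide)
      moreover have "(\<lambda>n. Re (ip h h) * t\<^sup>2 + 2 * (Re (ip (s n) h) - Re (\<phi> h)) * t)
          \<longlonglongrightarrow> Re (ip h h) * t\<^sup>2 + 2 * (Re (ip k h) - Re (\<phi> h)) * t"
        by (intro tendsto_intros lim_h)
      ultimately show "0 \<le> Re (ip h h) * t\<^sup>2 + 2 * (Re (ip k h) - Re (\<phi> h)) * t + 0"
        by (auto intro: LIMSEQ_le)
    qed (use h ip_nonneg in auto)
    then show ?thesis by simp
  qed
  have "\<phi> f = ip f k" if f: "f \<in> H" for f
  proof (rule complex_eqI)
    show "Re (\<phi> f) = Re (ip f k)" using Re_eq[OF f] Re_ip_commute[OF f k] by simp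
    \<comment> \<open>The imaginary part of a complex linear functional at \<open>f\<close> is its real part at \<open>- \<i> f\<close>.\<close>
    have "Re (\<phi> (\<lambda>x. - \<i> * f x)) = Re (ip (\<lambda>x. - \<i> * f x) k)"
      using Re_eq[OF scale_mem[OF f]] Re_ip_commute[OF scale_mem[OF f] k] by metis
    then show "Im (\<phi> f) = Im (ip f k)"
      unfolding scale[OF f] ip_scale[OF f k] by simp
  qed
  then show ?thesis using k by (intro ex1I[of _ k]) (auto intro: eq_if_ip_eq)
qed

section \<open>Adjoints and Berezin symbols\<close>

lemma hadjoint:
  assumes A: "bounded_operator H ip A" and g: "g \<in> H"
  shows hadjoint_mem: "hadjoint H ip A g \<in> H"
    and ip_hadjoint: "\<And>f. f \<in> H \<Longrightarrow> ip f (hadjoint H ip A g) = ip (A f) g"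
proof -
  have mem: "\<And>f. f \<in> H \<Longrightarrow> A f \<in> H"
    and A_add: "\<And>f f'. f \<in> H \<Longrightarrow> f' \<in> H \<Longrightarrow> A (\<lambda>x. f x + f' x) = (\<lambda>x. A f x + A f' x)"
    and A_scale: "\<And>c f. f \<in> H \<Longrightarrow> A (\<lambda>x. c * f x) = (\<lambda>x. c * A f x)"
    using A unfolding bounded_operator_def by blast+
  from A obtain C where C: "\<And>f. f \<in> H \<Longrightarrow> ip_norm ip (A f) \<le> C * ip_norm ip f"
    unfolding bounded_operator_def by blast
  have "\<exists>!h. h \<in> H \<and> (\<forall>f\<in>H. ip (A f) g = ip f h)"
  proof (rule riesz_representation[where C = "C * ip_norm ip g"])
    fix f assume f: "f \<in> H"
    have "cmod (ip (A f) g) \<le> ip_norm ip (A f) * ip_norm ip g"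
      using mem[OF f] g by (rule cauchy_schwarz)
    also have "\<dots> \<le> (C * ip_norm ip f) * ip_norm ip g"
      using C[OF f] ip_norm_nonneg[OF g] by (rule mult_right_mono)
    finally show "cmod (ip (A f) g) \<le> C * ip_norm ip g * ip_norm ip f" by (simp add: mult_ac)
  qed (use mem g in \<open>auto simp: A_add A_scale ip_add ip_scale\<close>)
  from theI'[OF this] show "hadjoint H ip A g \<in> H"
    and "\<And>f. f \<in> H \<Longrightarrow> ip f (hadjoint H ip A g) = ip (A f) g"
    unfolding hadjoint_def by auto
qed

lemma ip_hadjoint_self:
  assumes "bounded_operator H ip A" "f \<in> H"
  shows "ip (hadjoint H ip A f) f = cnj (ip (A f) f)"
  using ip_cnj[OF assms(2) hadjoint_mem[OF assms]] ip_hadjoint[OF assms assms(2)] by simp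

lemma ip_re_operator:
  assumes "bounded_operator H ip A" "f \<in> H"
  shows "ip (re_operator H ip A f) f = complex_of_real (Re (ip (A f) f))"
proof -
  have "A f \<in> H" using assms unfolding bounded_operator_def by blast
  moreover have "re_operator H ip A f = (\<lambda>x. (1/2) * (A f x + hadjoint H ip A f x))"
    by (simp add: re_operator_def)
  ultimately have "ip (re_operator H ip A f) f = (1/2) * (ip (A f) f + cnj (ip (A f) f))"
    using assms(2) hadjoint_mem[OF assms]
    by (simp only: ip_scale ip_add add_mem ip_hadjoint_self[OF assms])
  then show ?thesis by (simp add: complex_eq_iff)
qed

lemma ip_im_operator:
  assumes "bounded_operator H ip A" "f \<in> H"
  shows "ip (im_operator H ip A f) f = complex_of_real (Im (ip (A f) f))"
proof -
  have "A f \<in> H" using assms unfolding bounded_operator_def by blast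
  moreover have "im_operator H ip A f = (\<lambda>x. (1/(2*\<i>)) * (A f x - hadjoint H ip A f x))"
    by (simp add: im_operator_def)
  ultimately have "ip (im_operator H ip A f) f = (1/(2*\<i>)) * (ip (A f) f - cnj (ip (A f) f))"
    using assms(2) hadjoint_mem[OF assms]
    by (simp only: ip_scale ip_diff diff_mem ip_hadjoint_self[OF assms])
  then show ?thesis by (simp add: complex_eq_iff)
qed

end

context complex_rkhs
begin

lemma rkernel_mem: "rkernel H ip l \<in> H"
proof -
  obtain C where "\<And>f. f \<in> H \<Longrightarrow> cmod (f l) \<le> C * ip_norm ip f"
    using bounded_eval[of l] by blast
  then have "\<exists>!k. k \<in> H \<and> (\<forall>f\<in>H. f l = ip f k)"
    by (intro riesz_representation[where \<phi> = "\<lambda>f. f l"]) auto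
  from theI'[OF this] show ?thesis unfolding rkernel_def by blast
qed

lemma normalized_rkernel_eq:
  "normalized_rkernel H ip l
     = (\<lambda>x. complex_of_real (1 / ip_norm ip (rkernel H ip l)) * rkernel H ip l x)"
  by (simp add: normalized_rkernel_def)

lemma normalized_rkernel_mem: "normalized_rkernel H ip l \<in> H"
  unfolding normalized_rkernel_eq using rkernel_mem by (rule scale_mem)

lemma ip_norm_normalized_rkernel:
  assumes "rkernel H ip l \<noteq> (\<lambda>x. 0)"
  shows "ip_norm ip (normalized_rkernel H ip l) = 1"
proof -
  let ?k = "rkernel H ip l"
  have "ip_norm ip ?k \<noteq> 0" using ip_norm_eq_0[OF rkernel_mem] assms by blast
  then have "ip (normalized_rkernel H ip l) (normalized_rkernel H ip l) = 1"
    unfolding normalized_rkernel_eq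
    by (simp only: ip_scale ip_scale_right scale_mem rkernel_mem ip_self)
      (simp add: power2_eq_square)
  then show ?thesis by (simp add: ip_norm_def)
qed

end

theorem theorem3p1:
  fixes H :: "('a \<Rightarrow> complex) set"
    and ip :: "('a \<Rightarrow> complex) \<Rightarrow> ('a \<Rightarrow> complex) \<Rightarrow> complex"
    and A :: "('a \<Rightarrow> complex) \<Rightarrow> ('a \<Rightarrow> complex)"
  assumes "complex_rkhs H ip"
    and "\<And>l. rkernel H ip l \<noteq> (\<lambda>x. 0)"
    and "bounded_operator H ip A"
  shows "(berezin_number H ip (re_operator H ip A))\<^sup>2 + (berezin_number H ip (im_operator H ip A))\<^sup>2
           + (berezin_inf H ip (re_operator H ip A))\<^sup>2 + (berezin_inf H ip (im_operator H ip A))\<^sup>2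
           \<le> 2 * (berezin_number H ip A)\<^sup>2
         \<and> 2 * (berezin_number H ip A)\<^sup>2 \<le> 2 * (berezin_norm H ip A)\<^sup>2"
proof -
  interpret complex_rkhs H ip by fact
  let ?e = "normalized_rkernel H ip"
  define z where "z l m = ip (A (?e l)) (?e m)" for l m
  from assms(3) obtain C where C: "\<And>f. f \<in> H \<Longrightarrow> ip_norm ip (A f) \<le> C * ip_norm ip f"
    and mem: "\<And>f. f \<in> H \<Longrightarrow> A f \<in> H"
    unfolding bounded_operator_def by blast
  have bound: "cmod (z l m) \<le> C" for l m
    using cauchy_schwarz[OF mem[OF normalized_rkernel_mem] normalized_rkernel_mem, of l m]
      C[OF normalized_rkernel_mem, of l]
    by (simp add: z_def ip_norm_normalized_rkernel[OF assms(2)])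
  have number: "berezin_number H ip A = (SUP l. cmod (z l l))"
    by (simp add: berezin_number_def z_def)
  have norm: "berezin_norm H ip A = (SUP (l, m). cmod (z l m))"
    by (simp add: berezin_norm_def z_def)
  have bdd: "bdd_above (range (\<lambda>l. cmod (z l l)))"
    using bound by (intro bdd_aboveI2)
  have "berezin_number H ip (re_operator H ip A) = (SUP l. \<bar>Re (z l l)\<bar>)"
    "berezin_inf H ip (re_operator H ip A) = (INF l. \<bar>Re (z l l)\<bar>)"
    "berezin_number H ip (im_operator H ip A) = (SUP l. \<bar>Im (z l l)\<bar>)"
    "berezin_inf H ip (im_operator H ip A) = (INF l. \<bar>Im (z l l)\<bar>)"
    by (simp_all add: berezin_number_def berezin_inf_def z_def
        ip_re_operator[OF assms(3) normalized_rkernel_mem]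
        ip_im_operator[OF assms(3) normalized_rkernel_mem])
  with SUP_INF_Re_Im_le[OF bdd] have first:
    "(berezin_number H ip (re_operator H ip A))\<^sup>2 + (berezin_number H ip (im_operator H ip A))\<^sup>2
       + (berezin_inf H ip (re_operator H ip A))\<^sup>2 + (berezin_inf H ip (im_operator H ip A))\<^sup>2
       \<le> 2 * (berezin_number H ip A)\<^sup>2"
    by (simp add: number)
  have "bdd_above (range (\<lambda>(l, m). cmod (z l m)))"
    using bound by (intro bdd_aboveI2[where M = C]) auto
  then have "cmod (z l l) \<le> berezin_norm H ip A" for l
    unfolding norm using cSUP_upper[of "(l, l)" UNIV "\<lambda>(l, m). cmod (z l m)"] by simp
  then have "berezin_number H ip A \<le> berezin_norm H ip A"
    unfolding number by (intro cSUP_least) auto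
  moreover have "0 \<le> berezin_number H ip A"
    unfolding number using cSUP_upper[OF UNIV_I bdd, of undefined] norm_ge_zero order_trans by blast
  ultimately have "(berezin_number H ip A)\<^sup>2 \<le> (berezin_norm H ip A)\<^sup>2"
    by (rule power_mono)
  with first show ?thesis by simp
qed

end
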